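(* Consider the system on $\mathbb{C}^3\cong\mathbb{R}^6$ $$\dot z_1=(\alpha+i\beta)z_1+(\gamma+i\delta)|z_1|^2z_1+\varepsilon z_2,\quad \dot z_2=(a+ib)z_2+(c+id)|z_2|^2z_2+\varepsilon z_1,\quad \dot z_3=(\alpha+i\beta)z_3+(\gamma+i\delta)|z_3|^2z_3+\varepsilon z_2,$$ with real parameters satisfying $\alpha\gamma<0$, $ac<0$, $\beta\gamma-\alpha\delta\neq0$, $bc-ad\neq0$ and $\omega_1=\omega_3\neq\omega_2$, where $\omega_1=\omega_3:=\beta-\alpha\delta/\gamma$ and $\omega_2:=b-ad/c$. Let $\omega=(\omega_1,\omega_2,\omega_3)$ and let $e_0(\phi)=(R_1e^{i\phi_1},R_2e^{i\phi_2},R_3e^{i\phi_3})$ with $R_1=R_3=\sqrt{-\alpha/\gamma}$, $R_2=\sqrt{-a/c}$. Then the expansions $e=e_0+\varepsilon e_1+\varepsilon^2e_2+\ldots$ of the embedding and ${\bf f}=\omega+\varepsilon{\bf f}_1+\varepsilon^2{\bf f}_2+\ldots$ of the reduced phase vector field can be chosen (that is, there are smooth $e_1,e_2:(\mathbb{R}/2\pi\mathbb{Z})^3\to\mathbb{C}^3$ and ${\bf f}_1,{\bf f}_2:(\mathbb{R}/2\pi\mathbb{Z})^3\to\mathbb{R}^3$ solving the first two iterative equations given in the context) such that ${\bf f}_1=0$ and $${\bf f}_2^{(1)}(\phi)-{\bf f}_2^{(3)}(\phi)=-A\sin(\phi_1-\phi_3)+B\,(1-\cos(\phi_1-\phi_3)),$$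 so that, along $\dot\phi=\omega+\varepsilon{\bf f}_1(\phi)+\varepsilon^2{\bf f}_2(\phi)+\mathcal{O}(\varepsilon^3)$, the combination angle $\Phi:=\phi_1-\phi_3$ satisfies $$\dot\Phi=\varepsilon^2\left(-A\sin\Phi+B(1-\cos\Phi)\right)+\mathcal{O}(\varepsilon^3),$$ where $$A=\frac{1}{4a^2+(\omega_1-\omega_2)^2}\left(\frac{\delta}{\gamma}(\omega_2-\omega_1)+a\left(1+\frac{d\delta}{c\gamma}\right)+2a^2\left(\frac dc+\frac\delta\gamma\right)\frac{1}{\omega_2-\omega_1}\right),$$ $$B=\frac{1}{4a^2+(\omega_1-\omega_2)^2}\left((\omega_2-\omega_1)+a\left(\frac dc-\frac\delta\gamma\right)+2a^2\left(1-\frac{d\delta}{c\gamma}\right)\frac{1}{\omega_2-\omega_1}\right).$$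
   Context: Write the system as $\dot z={\bf F}_0(z)+\varepsilon{\bf F}_1(z)$, with ${\bf F}_0$ the uncoupled part and ${\bf F}_1(z_1,z_2,z_3)=(z_2,z_1,z_2)$; all derivatives are real derivatives on $\mathbb{C}^3\cong\mathbb{R}^6$. The embedding $e_0:(\mathbb{R}/2\pi\mathbb{Z})^3\to\mathbb{C}^3$ satisfies $\partial_\omega e_0={\bf F}_0\circ e_0$, where $\partial_\omega A:=A'\cdot\omega$. Expanding the conjugacy equation $e'\cdot{\bf f}=({\bf F}_0+\varepsilon{\bf F}_1)\circ e$ in powers of $\varepsilon$ gives the iterative equations $$(\partial_\omega-{\bf F}_0'\circ e_0)\cdot e_1+e_0'\cdot{\bf f}_1={\bf F}_1\circ e_0,$$ $$(\partial_\omega-{\bf F}_0'\circ e_0)\cdot e_2+e_0'\cdot{\bf f}_2=({\bf F}_1'\circ e_0)\cdot e_1+\tfrac12({\bf F}_0''\circ e_0)(e_1,e_1)-e_1'\cdot{\bf f}_1.$$ Superscripts $(1),(3)$ denote the first and third components. Solutions of these equations are not unique; the assertion is that they can be chosen as stated. *)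

theory Defs
  imports "HOL-Analysis.Analysis"
begin

abbreviation real_deriv ::
    "('a::real_normed_vector \<Rightarrow> 'b::real_normed_vector) \<Rightarrow> 'a \<Rightarrow> 'a \<Rightarrow> 'b"
  where "real_deriv f x v \<equiv> frechet_derivative f (at x) v"

definition second_deriv ::
    "('a::real_normed_vector \<Rightarrow> 'b::real_normed_vector) \<Rightarrow> 'a \<Rightarrow> 'a \<Rightarrow> 'a \<Rightarrow> 'b"
  where "second_deriv f x v w = real_deriv (\<lambda>y. real_deriv f y v) x w"

primrec Ck :: "nat \<Rightarrow> ('a::euclidean_space \<Rightarrow> 'b::real_normed_vector) \<Rightarrow> bool" where
  "Ck 0 f \<longleftrightarrow> continuous_on UNIV f"
| "Ck (Suc k) f \<longleftrightarrow> (\<forall>x. f differentiable (at x)) \<and> (\<forall>v. Ck k (\<lambda>x. real_deriv f x v))"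

definition smooth :: "('a::euclidean_space \<Rightarrow> 'b::real_normed_vector) \<Rightarrow> bool"
  where "smooth f \<longleftrightarrow> (\<forall>k. Ck k f)"

text \<open>Smooth maps on the torus \<open>(\<real>/2\<pi>\<int>)\<^sup>3\<close> are represented by their lifts to \<open>\<real>\<^sup>3\<close>.\<close>

definition smooth_on_torus :: "(real ^ 3 \<Rightarrow> 'b::real_normed_vector) \<Rightarrow> bool"
  where "smooth_on_torus f \<longleftrightarrow>
    smooth f \<and> (\<forall>\<phi> j. f (\<phi> + axis j (2 * pi)) = f \<phi>)"

definition oscillator :: "real \<Rightarrow> real \<Rightarrow> real \<Rightarrow> real \<Rightarrow> complex \<Rightarrow> complex"
  where "oscillator \<alpha> \<beta> \<gamma> \<delta> z =
    Complex \<alpha> \<beta> * z + Complex \<gamma> \<delta> * complex_of_real ((cmod z)\<^sup>2) * z"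

definition F0 ::
    "real \<Rightarrow> real \<Rightarrow> real \<Rightarrow> real \<Rightarrow> real \<Rightarrow> real \<Rightarrow> real \<Rightarrow> real \<Rightarrow> complex ^ 3 \<Rightarrow> complex ^ 3"
  where "F0 \<alpha> \<beta> \<gamma> \<delta> a b c d z = vector
    [oscillator \<alpha> \<beta> \<gamma> \<delta> (z $ 1), oscillator a b c d (z $ 2), oscillator \<alpha> \<beta> \<gamma> \<delta> (z $ 3)]"

definition F1 :: "complex ^ 3 \<Rightarrow> complex ^ 3"
  where "F1 z = vector [z $ 2, z $ 1, z $ 2]"

lemma full_system_components:
  fixes \<epsilon> \<alpha> \<beta> \<gamma> \<delta> a b c d :: real and z :: "complex ^ 3"
  defines "F \<equiv> F0 \<alpha> \<beta> \<gamma> \<delta> a b c d z + \<epsilon> *\<^sub>R F1 z"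
  shows "F $ 1 = (of_real \<alpha> + \<i> * of_real \<beta>) * z $ 1
           + (of_real \<gamma> + \<i> * of_real \<delta>) * of_real ((cmod (z $ 1))\<^sup>2) * z $ 1 + of_real \<epsilon> * z $ 2"
    and "F $ 2 = (of_real a + \<i> * of_real b) * z $ 2
           + (of_real c + \<i> * of_real d) * of_real ((cmod (z $ 2))\<^sup>2) * z $ 2 + of_real \<epsilon> * z $ 1"
    and "F $ 3 = (of_real \<alpha> + \<i> * of_real \<beta>) * z $ 3
           + (of_real \<gamma> + \<i> * of_real \<delta>) * of_real ((cmod (z $ 3))\<^sup>2) * z $ 3 + of_real \<epsilon> * z $ 2"
  unfolding F_def F0_def F1_def oscillator_def
  by (simp_all add: vector_3 Complex_eq scaleR_conv_of_real [where 'a = complex])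

definition limit_cycle_radius :: "real \<Rightarrow> real \<Rightarrow> real"
  where "limit_cycle_radius \<alpha> \<gamma> = sqrt (- \<alpha> / \<gamma>)"

definition limit_cycle_frequency :: "real \<Rightarrow> real \<Rightarrow> real \<Rightarrow> real \<Rightarrow> real"
  where "limit_cycle_frequency \<alpha> \<beta> \<gamma> \<delta> = \<beta> - \<alpha> * \<delta> / \<gamma>"

definition embedding0 :: "real \<Rightarrow> real \<Rightarrow> real \<Rightarrow> real ^ 3 \<Rightarrow> complex ^ 3"
  where "embedding0 R\<^sub>1 R\<^sub>2 R\<^sub>3 \<phi> = vector
    [of_real R\<^sub>1 * cis (\<phi> $ 1), of_real R\<^sub>2 * cis (\<phi> $ 2), of_real R\<^sub>3 * cis (\<phi> $ 3)]"

text \<open>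
  The first two iterative equations, obtained by expanding
  \<open>e' \<cdot> f = (F\<^sub>0 + \<epsilon> F\<^sub>1) \<circ> e\<close> in powers of \<open>\<epsilon>\<close>,
  with \<open>\<partial>\<^sub>\<omega> A = A' \<cdot> \<omega>\<close>.
\<close>

definition first_iterative_eq ::
    "(complex ^ 3 \<Rightarrow> complex ^ 3) \<Rightarrow> (complex ^ 3 \<Rightarrow> complex ^ 3) \<Rightarrow> real ^ 3
     \<Rightarrow> (real ^ 3 \<Rightarrow> complex ^ 3) \<Rightarrow> (real ^ 3 \<Rightarrow> complex ^ 3) \<Rightarrow> (real ^ 3 \<Rightarrow> real ^ 3) \<Rightarrow> bool"
  where "first_iterative_eq G0 G1 \<omega> e0 e1 f1 \<longleftrightarrow> (\<forall>\<phi>.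
    real_deriv e1 \<phi> \<omega> - real_deriv G0 (e0 \<phi>) (e1 \<phi>) + real_deriv e0 \<phi> (f1 \<phi>)
      = G1 (e0 \<phi>))"

definition second_iterative_eq ::
    "(complex ^ 3 \<Rightarrow> complex ^ 3) \<Rightarrow> (complex ^ 3 \<Rightarrow> complex ^ 3) \<Rightarrow> real ^ 3
     \<Rightarrow> (real ^ 3 \<Rightarrow> complex ^ 3) \<Rightarrow> (real ^ 3 \<Rightarrow> complex ^ 3) \<Rightarrow> (real ^ 3 \<Rightarrow> complex ^ 3)
     \<Rightarrow> (real ^ 3 \<Rightarrow> real ^ 3) \<Rightarrow> (real ^ 3 \<Rightarrow> real ^ 3) \<Rightarrow> bool"
  where "second_iterative_eq G0 G1 \<omega> e0 e1 e2 f1 f2 \<longleftrightarrow> (\<forall>\<phi>.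
    real_deriv e2 \<phi> \<omega> - real_deriv G0 (e0 \<phi>) (e2 \<phi>) + real_deriv e0 \<phi> (f2 \<phi>)
      = real_deriv G1 (e0 \<phi>) (e1 \<phi>)
        + (1 / 2) *\<^sub>R second_deriv G0 (e0 \<phi>) (e1 \<phi>) (e1 \<phi>)
        - real_deriv e1 \<phi> (f1 \<phi>))"

text \<open>
  The phase field is only known up to \<open>O(\<epsilon>\<^sup>3)\<close>, uniformly in the phase; \<open>f \<epsilon>\<close> ranges
  over all families of vector fields with the given second order expansion.
\<close>

definition phase_field_expansion ::
    "(real \<Rightarrow> real ^ 3 \<Rightarrow> real ^ 3) \<Rightarrow> real ^ 3 \<Rightarrow> (real ^ 3 \<Rightarrow> real ^ 3) \<Rightarrow> (real ^ 3 \<Rightarrow> real ^ 3) \<Rightarrow> bool"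
  where "phase_field_expansion f \<omega> f1 f2 \<longleftrightarrow> (\<exists>C. \<exists>\<epsilon>0>0. \<forall>\<epsilon> \<phi>. \<bar>\<epsilon>\<bar> < \<epsilon>0 \<longrightarrow>
    norm (f \<epsilon> \<phi> - (\<omega> + \<epsilon> *\<^sub>R f1 \<phi> + \<epsilon>\<^sup>2 *\<^sub>R f2 \<phi>)) \<le> C * \<bar>\<epsilon>\<bar> ^ 3)"

definition solves_ode :: "(real \<Rightarrow> real ^ 3) \<Rightarrow> (real ^ 3 \<Rightarrow> real ^ 3) \<Rightarrow> real set \<Rightarrow> bool"
  where "solves_ode \<phi> f I \<longleftrightarrow>
    (\<forall>t\<in>I. (\<phi> has_vector_derivative f (\<phi> t)) (at t within I))"

text \<open>
  \<open>d\<Phi>/dt = \<epsilon>\<^sup>2 g(\<Phi>) + O(\<epsilon>\<^sup>3)\<close> for \<open>\<Phi> = \<phi>\<^sub>1 - \<phi>\<^sub>3\<close>, with the remainder uniform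
  over all solutions and all times.
\<close>

definition combination_angle_law ::
    "(real \<Rightarrow> real ^ 3 \<Rightarrow> real ^ 3) \<Rightarrow> (real \<Rightarrow> real) \<Rightarrow> bool"
  where "combination_angle_law f g \<longleftrightarrow> (\<exists>C. \<exists>\<epsilon>0>0. \<forall>\<epsilon> I \<phi>.
    \<bar>\<epsilon>\<bar> < \<epsilon>0 \<and> is_interval I \<and> solves_ode \<phi> (f \<epsilon>) I \<longrightarrow>
      (\<forall>t\<in>I. \<exists>D.
        ((\<lambda>s. \<phi> s $ 1 - \<phi> s $ 3) has_real_derivative D) (at t within I) \<and>
        \<bar>D - \<epsilon>\<^sup>2 * g (\<phi> t $ 1 - \<phi> t $ 3)\<bar> \<le> C * \<bar>\<epsilon>\<bar> ^ 3))"

end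

theory Submission
  imports Defs
begin

text \<open>
  In the frame rotating with oscillator \<open>j\<close>, spanned by \<open>1 + \<i> \<delta>/\<gamma>\<close> and the tangent direction
  \<open>\<i>\<close>, the iterative equations decouple into \<open>(\<partial>\<^sub>\<omega> + 2 \<alpha>) x = p\<close>, solvable for every
  trigonometric polynomial \<open>p\<close>, and \<open>\<partial>\<^sub>\<omega> y + R f = q\<close>, where \<open>f\<close> only has to absorb the
  resonant waves of \<open>q\<close>. At first order all waves depend on \<open>\<plusminus>(\<phi>\<^sub>1 - \<phi>\<^sub>2)\<close> or
  \<open>\<plusminus>(\<phi>\<^sub>3 - \<phi>\<^sub>2)\<close> and are nonresonant, so \<open>f\<^sub>1 = 0\<close>. At second order the resonant waves are
  constants, except for one wave in \<open>\<phi>\<^sub>1 - \<phi>\<^sub>3\<close>, by which oscillator 3 sees oscillator 1 through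
  oscillator 2; its amplitude is the Fourier coefficient \<open>harmonic_pos\<close> of the response of
  oscillator 2 and gives \<open>A\<close> and \<open>B\<close>.
\<close>

section \<open>Frechet derivatives of vector-valued maps, component by component\<close>

lemma real_deriv_eqI: "(f has_derivative f') (at x) \<Longrightarrow> real_deriv f x v = f' v"
  by (metis frechet_derivative_at)

lemma has_derivative_vec:
  fixes f :: "'a::real_normed_vector \<Rightarrow> 'b::euclidean_space ^ 'n"
  assumes "\<And>i. ((\<lambda>x. f x $ i) has_derivative (\<lambda>v. f' v $ i)) (at x)"
  shows "(f has_derivative f') (at x)"
  unfolding has_derivative_componentwise_within [of f]
  by (auto simp: Basis_vec_def inner_axis intro!: has_derivative_inner_left assms)

lemma differentiable_vec:
  fixes f :: "'a::real_normed_vector \<Rightarrow> 'b::euclidean_space ^ 'n"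
  assumes "\<And>i. (\<lambda>x. f x $ i) differentiable (at x)"
  shows "f differentiable (at x)"
    and "real_deriv f x v $ i = real_deriv (\<lambda>x. f x $ i) x v"
proof -
  have "(f has_derivative (\<lambda>v. \<chi> i. real_deriv (\<lambda>x. f x $ i) x v)) (at x)"
    using assms by (intro has_derivative_vec) (simp add: frechet_derivative_works)
  then show "f differentiable (at x)" "real_deriv f x v $ i = real_deriv (\<lambda>x. f x $ i) x v"
    by (auto simp: differentiable_def real_deriv_eqI)
qed

subsection \<open>Closure properties of smooth maps\<close>

text \<open>\<open>Ck\<close> refers to \<open>frechet_derivative\<close>, which is chosen by
  description. Uniqueness of the derivative at a point lets any explicitly known derivative take its
  place.\<close>

lemma Ck_SucI:
  assumes "\<And>x. (f has_derivative f' x) (at x)" and "\<And>v. Ck k (\<lambda>x. f' x v)"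
  shows "Ck (Suc k) f"
  using assms by (auto simp: differentiable_def real_deriv_eqI [OF assms(1)])

lemma Ck_Suc_has_derivative: "Ck (Suc k) f \<Longrightarrow> (f has_derivative real_deriv f x) (at x)"
  by (simp add: frechet_derivative_works)

text \<open>At the bottom level differentiability gives continuity; above it the induction
  hypothesis applies to the directional derivatives. The product rule needs this, since it leaves
  one factor undifferentiated.\<close>

lemma Ck_Suc_imp_Ck: "Ck (Suc k) f \<Longrightarrow> Ck k f"
proof (induction k arbitrary: f)
  case 0
  then show ?case
    by (auto simp: continuous_on_eq_continuous_at intro!: differentiable_imp_continuous_within)
qed auto

lemma Ck_const: "Ck k (\<lambda>x. c)"
proof (induction k arbitrary: c)
  case (Suc k)
  show ?case
    by (rule Ck_SucI [where f' = "\<lambda>x v. 0"]) (auto intro: Suc)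
qed auto

lemma Ck_add: "Ck k f \<Longrightarrow> Ck k g \<Longrightarrow> Ck k (\<lambda>x. f x + g x)"
proof (induction k arbitrary: f g)
  case (Suc k)
  show ?case
    by (rule Ck_SucI [OF has_derivative_add [OF Suc.prems [THEN Ck_Suc_has_derivative]]])
      (use Suc in auto)
qed (auto intro: continuous_intros)

lemma Ck_mult:
  fixes f g :: "'a::euclidean_space \<Rightarrow> 'b::real_normed_algebra"
  shows "Ck k f \<Longrightarrow> Ck k g \<Longrightarrow> Ck k (\<lambda>x. f x * g x)"
proof (induction k arbitrary: f g)
  case (Suc k)
  show ?case
    by (rule Ck_SucI [OF has_derivative_mult [OF Suc.prems [THEN Ck_Suc_has_derivative]]])
      (intro Ck_add Suc.IH Suc.prems [THEN Ck_Suc_imp_Ck]; use Suc.prems in simp)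
qed (auto intro: continuous_intros)

lemma Ck_bounded_linear: "bounded_linear L \<Longrightarrow> Ck k f \<Longrightarrow> Ck k (\<lambda>x. L (f x))"
proof (induction k arbitrary: f)
  case (Suc k)
  show ?case
    by (rule Ck_SucI [OF bounded_linear.has_derivative
          [OF Suc.prems(1) Ck_Suc_has_derivative [OF Suc.prems(2)]]])
      (use Suc in auto)
qed (auto simp: bounded_linear.continuous_on)

lemma Ck_vec:
  fixes f :: "'a::euclidean_space \<Rightarrow> 'b::euclidean_space ^ 'n"
  shows "(\<And>i. Ck k (\<lambda>x. f x $ i)) \<Longrightarrow> Ck k f"
proof (induction k arbitrary: f)
  case 0
  then have "continuous_on UNIV (\<lambda>x. \<chi> i. f x $ i)"
    by (intro continuous_on_vec_lambda) auto
  then show ?case by simp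
next
  case (Suc k)
  then show ?case
    by (auto simp: differentiable_vec)
qed

lemma has_derivative_wave:
  "((\<lambda>x. C * cis (k \<bullet> x)) has_derivative (\<lambda>v. \<i> * of_real (k \<bullet> v) * C * cis (k \<bullet> x))) (at x)"
proof -
  have "((\<lambda>x. \<i> * complex_of_real (k \<bullet> x)) has_derivative (\<lambda>v. \<i> * of_real (k \<bullet> v))) (at x)"
    by (auto intro!: derivative_eq_intros)
  from has_derivative_compose [OF this DERIV_exp [unfolded has_field_derivative_def]]
  have "((\<lambda>x. C * exp (\<i> * complex_of_real (k \<bullet> x))) has_derivative
      (\<lambda>v. C * (exp (\<i> * complex_of_real (k \<bullet> x)) * (\<i> * of_real (k \<bullet> v))))) (at x)"
    by (rule has_derivative_mult_right)
  then show ?thesis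
    by (simp add: cis_conv_exp mult_ac)
qed

text \<open>Differentiating a wave only changes its amplitude, so induction over all amplitudes
  closes.\<close>

lemma Ck_wave:
  fixes k :: "'a::euclidean_space"
  shows "Ck n (\<lambda>x. C * cis (k \<bullet> x))"
proof (induction n arbitrary: C)
  case (Suc n)
  show ?case
    by (rule Ck_SucI [OF has_derivative_wave]) (rule Suc)
qed (auto simp: cis_conv_exp intro!: continuous_intros)

subsection \<open>Trigonometric polynomials\<close>

text \<open>Complex amplitudes cover sines and cosines at once. The predicate \<open>K\<close>
  records the admissible frequencies, so that integrality and nonresonance are preserved by sums and
  by solving equations.\<close>

inductive trig_poly :: "('a::real_inner \<Rightarrow> bool) \<Rightarrow> ('a \<Rightarrow> real) \<Rightarrow> bool" for K where
  wave: "K k \<Longrightarrow> trig_poly K (\<lambda>x. Re (C * cis (k \<bullet> x)))"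
| add: "trig_poly K f \<Longrightarrow> trig_poly K g \<Longrightarrow> trig_poly K (\<lambda>x. f x + g x)"

lemma trig_poly_mono: "trig_poly K f \<Longrightarrow> (\<And>k. K k \<Longrightarrow> K' k) \<Longrightarrow> trig_poly K' f"
  by (induction rule: trig_poly.induct) (blast intro: trig_poly.intros)+

lemma trig_poly_const: "K 0 \<Longrightarrow> trig_poly K (\<lambda>x. c)"
  using trig_poly.wave [of K 0 "of_real c"] by simp

lemma Ck_trig_poly:
  fixes f :: "'a::euclidean_space \<Rightarrow> real"
  shows "trig_poly K f \<Longrightarrow> Ck n f"
  by (induction rule: trig_poly.induct)
    (blast intro: Ck_add Ck_bounded_linear [OF bounded_linear_Re Ck_wave])+

lemma trig_poly_differentiable:
  fixes f :: "'a::euclidean_space \<Rightarrow> real"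
  shows "trig_poly K f \<Longrightarrow> f differentiable (at x)"
  using Ck_trig_poly [of K f 1] by simp

lemma trig_poly_periodic:
  fixes f :: "real ^ 'n \<Rightarrow> real"
  assumes "trig_poly K f" and "\<And>k. K k \<Longrightarrow> k $ j \<in> \<int>"
  shows "f (\<phi> + axis j (2 * pi)) = f \<phi>"
  using assms(1)
proof (induction rule: trig_poly.induct)
  case (wave k C)
  have "cis (k $ j * (2 * pi)) = 1"
    using cis_multiple_2pi [OF assms(2) [OF wave]] by (simp add: ac_simps)
  then show ?case
    by (simp add: inner_add_right inner_axis flip: cis_mult)
qed auto

text \<open>On a wave of frequency \<open>k\<close> the operator \<open>\<partial>\<^sub>\<omega> + \<mu>\<close> is multiplication by \<open>\<mu> + \<i> (k \<bullet> \<omega>)\<close>.\<close>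

lemma wave_directional_solution:
  fixes C :: complex
  assumes "\<mu> \<noteq> 0 \<or> k \<bullet> \<omega> \<noteq> 0"
  defines "f \<equiv> \<lambda>x. Re (C / Complex \<mu> (k \<bullet> \<omega>) * cis (k \<bullet> x))"
  shows "real_deriv f x \<omega> + \<mu> * f x = Re (C * cis (k \<bullet> x))"
proof -
  let ?m = "Complex \<mu> (k \<bullet> \<omega>)"
  have m: "?m \<noteq> 0" "\<i> * of_real (k \<bullet> \<omega>) + of_real \<mu> = ?m"
    using assms(1) by (auto simp: complex_eq_iff)
  have "real_deriv f x \<omega> = Re (\<i> * of_real (k \<bullet> \<omega>) * (C / ?m) * cis (k \<bullet> x))"
    unfolding f_def
    by (rule real_deriv_eqI [OF bounded_linear.has_derivative
        [OF bounded_linear_Re has_derivative_wave]])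
  then have "real_deriv f x \<omega> + \<mu> * f x
      = Re ((\<i> * of_real (k \<bullet> \<omega>) + of_real \<mu>) * (C / ?m) * cis (k \<bullet> x))"
    unfolding f_def by (simp only: distrib_right mult.assoc plus_complex.sel)
      (simp only: times_complex.sel Re_complex_of_real Im_complex_of_real mult_zero_left diff_zero)
  also have "\<dots> = Re (C * cis (k \<bullet> x))"
    using m by simp
  finally show ?thesis .
qed

text \<open>Superposition of the solutions for single waves. The sum is finite, so nonvanishing
  multipliers suffice and no small-divisor estimate arises; the frequencies remain in
  \<open>K\<close>.\<close>

lemma trig_poly_directional_solution:
  fixes h :: "'a::euclidean_space \<Rightarrow> real"
  assumes "trig_poly K h" and "\<And>k. K k \<Longrightarrow> \<mu> \<noteq> 0 \<or> k \<bullet> \<omega> \<noteq> 0"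
  obtains f where "trig_poly K f" and "\<And>x. real_deriv f x \<omega> + \<mu> * f x = h x"
proof -
  from assms(1) have "\<exists>f. trig_poly K f \<and> (\<forall>x. real_deriv f x \<omega> + \<mu> * f x = h x)"
  proof (induction rule: trig_poly.induct)
    case (wave k C)
    then show ?case
      using wave_directional_solution [OF assms(2) [OF wave], of C]
      by (intro exI [of _ "\<lambda>x. Re (C / Complex \<mu> (k \<bullet> \<omega>) * cis (k \<bullet> x))"])
        (blast intro: trig_poly.wave)
  next
    case (add h g)
    then obtain f f' where *: "trig_poly K f" "trig_poly K f'"
      "\<And>x. real_deriv f x \<omega> + \<mu> * f x = h x" "\<And>x. real_deriv f' x \<omega> + \<mu> * f' x = g x"
      by blast
    have "real_deriv (\<lambda>x. f x + f' x) x \<omega> = real_deriv f x \<omega> + real_deriv f' x \<omega>" for x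
      by (intro real_deriv_eqI has_derivative_add)
        (simp_all add: *(1,2) [THEN trig_poly_differentiable] flip: frechet_derivative_works)
    then show ?case
      using * by (intro exI [of _ "\<lambda>x. f x + f' x"])
        (auto intro: trig_poly.add simp: distrib_left simp flip: *(3,4))
  qed
  then show thesis using that by blast
qed

subsection \<open>Linearisation along the limit cycles\<close>

text \<open>The cubic term is \<open>z\<^sup>2 * cnj z\<close>. Its differential has an antilinear
  part in \<open>cnj w\<close>, so it is linear over the reals only.\<close>

definition oscillator_deriv ::
    "real \<Rightarrow> real \<Rightarrow> real \<Rightarrow> real \<Rightarrow> complex \<Rightarrow> complex \<Rightarrow> complex"
  where "oscillator_deriv \<alpha> \<beta> \<gamma> \<delta> z w =
    Complex \<alpha> \<beta> * w + Complex \<gamma> \<delta> * (2 * (z * cnj z) * w + z\<^sup>2 * cnj w)"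

lemma has_derivative_oscillator:
  "(oscillator \<alpha> \<beta> \<gamma> \<delta> has_derivative oscillator_deriv \<alpha> \<beta> \<gamma> \<delta> z) (at z)"
proof -
  have "oscillator \<alpha> \<beta> \<gamma> \<delta> = (\<lambda>z. Complex \<alpha> \<beta> * z + Complex \<gamma> \<delta> * (z * cnj z) * z)"
    unfolding oscillator_def complex_norm_square ..
  moreover have "(\<dots> has_derivative oscillator_deriv \<alpha> \<beta> \<gamma> \<delta> z) (at z)"
    by (rule derivative_eq_intros refl)+
      (simp add: fun_eq_iff oscillator_deriv_def algebra_simps power2_eq_square)
  ultimately show ?thesis by simp
qed

lemma has_derivative_oscillator_deriv:
  "((\<lambda>z. oscillator_deriv \<alpha> \<beta> \<gamma> \<delta> z v) has_derivative
    (\<lambda>w. Complex \<gamma> \<delta> * (2 * (z * cnj w + w * cnj z) * v + 2 * z * w * cnj v))) (at z)"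
  unfolding oscillator_deriv_def power2_eq_square
  by (rule derivative_eq_intros refl)+ (simp add: fun_eq_iff algebra_simps)

lemma has_derivative_vec_nth:
  "((\<lambda>x::'a::real_normed_vector ^ 'n. x $ i) has_derivative (\<lambda>v. v $ i)) F"
  by (rule bounded_linear.has_derivative [OF bounded_linear_vec_nth has_derivative_ident])

lemma has_derivative_vector3:
  fixes f g h :: "'a::real_normed_vector \<Rightarrow> 'b::euclidean_space"
  assumes "(f has_derivative f') (at x)" "(g has_derivative g') (at x)"
    "(h has_derivative h') (at x)"
  shows "((\<lambda>x. vector [f x, g x, h x] :: 'b ^ 3) has_derivative (\<lambda>v. vector [f' v, g' v, h' v])) (at x)"
proof (rule has_derivative_vec)
  fix i :: 3
  show "((\<lambda>x. (vector [f x, g x, h x] :: 'b ^ 3) $ i) has_derivative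
      (\<lambda>v. (vector [f' v, g' v, h' v] :: 'b ^ 3) $ i)) (at x)"
    using exhaust_3 [of i] assms by auto
qed

lemma real_deriv_F0:
  "real_deriv (F0 \<alpha> \<beta> \<gamma> \<delta> a b c d) z w = vector
    [oscillator_deriv \<alpha> \<beta> \<gamma> \<delta> (z $ 1) (w $ 1), oscillator_deriv a b c d (z $ 2) (w $ 2),
     oscillator_deriv \<alpha> \<beta> \<gamma> \<delta> (z $ 3) (w $ 3)]"
  unfolding F0_def [abs_def]
  by (rule real_deriv_eqI) (intro has_derivative_vector3
      has_derivative_compose [OF has_derivative_vec_nth has_derivative_oscillator])

text \<open>The factor 2 is pulled out in front to cancel the 1/2 of the second iterative
  equation.\<close>

lemma second_deriv_F0:
  "second_deriv (F0 \<alpha> \<beta> \<gamma> \<delta> a b c d) z w w = 2 *\<^sub>R vector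
    [Complex \<gamma> \<delta> * ((w $ 1)\<^sup>2 * cnj (z $ 1) + 2 * z $ 1 * (w $ 1 * cnj (w $ 1))),
     Complex c d * ((w $ 2)\<^sup>2 * cnj (z $ 2) + 2 * z $ 2 * (w $ 2 * cnj (w $ 2))),
     Complex \<gamma> \<delta> * ((w $ 3)\<^sup>2 * cnj (z $ 3) + 2 * z $ 3 * (w $ 3 * cnj (w $ 3)))]"
  (is "_ = ?rhs")
proof -
  have "second_deriv (F0 \<alpha> \<beta> \<gamma> \<delta> a b c d) z w w = vector
    [Complex \<gamma> \<delta> * (2 * (z $ 1 * cnj (w $ 1) + w $ 1 * cnj (z $ 1)) * w $ 1
        + 2 * z $ 1 * w $ 1 * cnj (w $ 1)),
     Complex c d * (2 * (z $ 2 * cnj (w $ 2) + w $ 2 * cnj (z $ 2)) * w $ 2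
        + 2 * z $ 2 * w $ 2 * cnj (w $ 2)),
     Complex \<gamma> \<delta> * (2 * (z $ 3 * cnj (w $ 3) + w $ 3 * cnj (z $ 3)) * w $ 3
        + 2 * z $ 3 * w $ 3 * cnj (w $ 3))]"
    unfolding second_deriv_def real_deriv_F0
    by (rule real_deriv_eqI) (intro has_derivative_vector3
        has_derivative_compose [OF has_derivative_vec_nth has_derivative_oscillator_deriv])
  also have "\<dots> = ?rhs"
    by (simp add: vec_eq_iff forall_3 scaleR_conv_of_real algebra_simps power2_eq_square)
  finally show ?thesis .
qed

lemma real_deriv_F1: "real_deriv F1 z w = F1 w"
  unfolding F1_def [abs_def]
  by (rule real_deriv_eqI) (intro has_derivative_vector3 has_derivative_vec_nth)

lemma has_derivative_phase:
  fixes \<phi> :: "real ^ 'n"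
  shows "((\<lambda>\<phi>. C * cis (\<phi> $ j)) has_derivative (\<lambda>v. \<i> * of_real (v $ j) * C * cis (\<phi> $ j))) (at \<phi>)"
  using has_derivative_wave [of C "axis j 1" \<phi>] by (simp add: inner_axis')

lemma real_deriv_embedding0:
  "real_deriv (embedding0 R\<^sub>1 R\<^sub>2 R\<^sub>3) \<phi> v = vector
    [\<i> * of_real (v $ 1) * R\<^sub>1 * cis (\<phi> $ 1), \<i> * of_real (v $ 2) * R\<^sub>2 * cis (\<phi> $ 2),
     \<i> * of_real (v $ 3) * R\<^sub>3 * cis (\<phi> $ 3)]"
  unfolding embedding0_def [abs_def]
  by (rule real_deriv_eqI) (intro has_derivative_vector3 has_derivative_phase)

text \<open>
  In the rotating frame \<open>cis \<phi>\<^sub>j\<close>, the isochron direction \<open>1 + \<i> \<delta>/\<gamma>\<close> is an eigenvector of the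
  linearisation with eigenvalue \<open>-2 \<alpha>\<close> and the tangent direction \<open>\<i>\<close> one with eigenvalue \<open>0\<close>.
\<close>

definition frame :: "'n \<Rightarrow> real \<Rightarrow> (real ^ 'n \<Rightarrow> real) \<Rightarrow> (real ^ 'n \<Rightarrow> real) \<Rightarrow> real ^ 'n \<Rightarrow> complex"
  where "frame j \<kappa> x y \<phi> = cis (\<phi> $ j) * Complex (x \<phi>) (\<kappa> * x \<phi> + y \<phi>)"

text \<open>Write \<open>u\<close> for the rotating-frame coordinate, so that
  \<open>Re u = x\<close>. Since \<alpha> + i \<beta> = i \<open>\<omega> $ j\<close> + \<alpha> (1
  + i \<kappa>) and (\<gamma> + i \<delta>) \<open>R\<^sup>2\<close> = - \<alpha> (1 + i \<kappa>),
  the linearisation sends \<open>u\<close> to i \<open>\<omega> $ j\<close> \<open>u\<close> - 2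
  \<alpha> \<open>x\<close> (1 + i \<kappa>). Its first term cancels against the derivative of the
  rotating factor.\<close>

lemma linearised_frame:
  assumes "\<gamma> \<noteq> 0" and R: "R\<^sup>2 = - \<alpha> / \<gamma>"
    and \<omega>: "\<omega> $ j = limit_cycle_frequency \<alpha> \<beta> \<gamma> \<delta>" and \<kappa>: "\<kappa> = \<delta> / \<gamma>"
    and "x differentiable (at \<phi>)" "y differentiable (at \<phi>)"
  shows "real_deriv (frame j \<kappa> x y) \<phi> \<omega>
      - oscillator_deriv \<alpha> \<beta> \<gamma> \<delta> (of_real R * cis (\<phi> $ j)) (frame j \<kappa> x y \<phi>)
    = frame j \<kappa> (\<lambda>\<phi>. real_deriv x \<phi> \<omega> + 2 * \<alpha> * x \<phi>) (\<lambda>\<phi>. real_deriv y \<phi> \<omega>) \<phi>"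
proof -
  let ?x' = "real_deriv x \<phi>" and ?y' = "real_deriv y \<phi>"
  \<comment> \<open>The factor \<open>1 *\<close> produces the shape
    \<open>C * cis (\<phi> $ j)\<close> that \<open>has_derivative_phase\<close> expects.\<close>
  have "frame j \<kappa> x y = (\<lambda>\<phi>. 1 * cis (\<phi> $ j) * (of_real (x \<phi>) * Complex 1 \<kappa> + of_real (y \<phi>) * \<i>))"
    by (auto simp: fun_eq_iff frame_def complex_eq_iff)
  moreover note dx = assms(5) [unfolded frechet_derivative_works]
    and dy = assms(6) [unfolded frechet_derivative_works]
  have "((\<lambda>\<phi>. 1 * cis (\<phi> $ j) * (of_real (x \<phi>) * Complex 1 \<kappa> + of_real (y \<phi>) * \<i>)) has_derivative (\<lambda>v. cis (\<phi> $ j) * (of_real (?x' v) * Complex 1 \<kappa> + of_real (?y' v) * \<i>)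
       + \<i> * of_real (v $ j) * cis (\<phi> $ j) * (of_real (x \<phi>) * Complex 1 \<kappa> + of_real (y \<phi>) * \<i>))) (at \<phi>)"
    by (rule has_derivative_phase dx dy derivative_eq_intros refl)+ simp
  ultimately have 1: "real_deriv (frame j \<kappa> x y) \<phi> \<omega> = cis (\<phi> $ j) *
      (of_real (?x' \<omega>) * Complex 1 \<kappa> + of_real (?y' \<omega>) * \<i>
       + \<i> * of_real (\<omega> $ j) * (of_real (x \<phi>) * Complex 1 \<kappa> + of_real (y \<phi>) * \<i>))"
    by (simp add: real_deriv_eqI algebra_simps)
  define u where "u = Complex (x \<phi>) (\<kappa> * x \<phi> + y \<phi>)"
  have z: "cis (\<phi> $ j) * cnj (cis (\<phi> $ j)) = 1"
    by (simp add: cis_cnj cis_mult)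
  have "oscillator_deriv \<alpha> \<beta> \<gamma> \<delta> (of_real R * cis (\<phi> $ j)) (frame j \<kappa> x y \<phi>)
    = cis (\<phi> $ j) * (Complex \<alpha> \<beta> * u + Complex \<gamma> \<delta> * of_real (R\<^sup>2) *
       (cis (\<phi> $ j) * cnj (cis (\<phi> $ j))) * (2 * u + cnj u))"
    unfolding oscillator_deriv_def frame_def u_def [symmetric]
    by (simp add: algebra_simps power2_eq_square)
  also have "\<dots> = cis (\<phi> $ j) * (Complex \<alpha> \<beta> * u + Complex \<gamma> \<delta> * of_real (- \<alpha> / \<gamma>) * (2 * u + cnj u))"
    unfolding z R by simp
  also have "Complex \<alpha> \<beta> * u + Complex \<gamma> \<delta> * of_real (- \<alpha> / \<gamma>) * (2 * u + cnj u)
     = \<i> * of_real (\<omega> $ j) * (of_real (x \<phi>) * Complex 1 \<kappa> + of_real (y \<phi>) * \<i>)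
       - of_real (2 * \<alpha> * x \<phi>) * Complex 1 \<kappa>"
    using \<open>\<gamma> \<noteq> 0\<close> by (simp add: complex_eq_iff u_def \<omega> \<kappa> limit_cycle_frequency_def field_simps)
  also note 2 = calculation
  show ?thesis
    unfolding 1 2 unfolding frame_def right_diff_distrib [symmetric]
    by (rule arg_cong [where f = "(*) (cis (\<phi> $ j))"]) (auto simp: complex_eq_iff algebra_simps)
qed

subsection \<open>Solving the iterative equations componentwise\<close>

abbreviation integral_vec :: "real ^ 'n \<Rightarrow> bool"
  where "integral_vec k \<equiv> \<forall>j. k $ j \<in> \<int>"

text \<open>Integrality makes the wave periodic on the torus; the second condition makes the
  tangential equation solvable for it.\<close>

abbreviation nonresonant :: "real ^ 'n \<Rightarrow> real ^ 'n \<Rightarrow> bool"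
  where "nonresonant \<omega> k \<equiv> integral_vec k \<and> k \<bullet> \<omega> \<noteq> 0"

lemma smooth_on_torus_trig_poly: "trig_poly integral_vec f \<Longrightarrow> smooth_on_torus f"
  by (simp add: smooth_on_torus_def smooth_def Ck_trig_poly trig_poly_periodic)

lemma smooth_on_torus_frame:
  assumes "trig_poly integral_vec x" "trig_poly integral_vec y"
  shows "smooth_on_torus (frame j \<kappa> x y)"
  unfolding smooth_on_torus_def smooth_def
proof (intro conjI allI)
  fix n
  have eq: "frame j \<kappa> x y = (\<lambda>\<phi>. 1 * cis (axis j 1 \<bullet> \<phi>) * (of_real (x \<phi>) * Complex 1 \<kappa> + of_real (y \<phi>) * \<i>))"
    by (auto simp: fun_eq_iff frame_def complex_eq_iff inner_axis')
  show "Ck n (frame j \<kappa> x y)"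
    unfolding eq
    by (intro Ck_mult Ck_add Ck_wave Ck_const Ck_bounded_linear [OF bounded_linear_of_real]
        assms [THEN Ck_trig_poly])
next
  fix \<phi> :: "real ^ 3" and i
  have "cis ((\<phi> + axis i (2 * pi)) $ j) = cis (\<phi> $ j)"
    by (simp add: axis_def flip: cis_mult)
  then show "frame j \<kappa> x y (\<phi> + axis i (2 * pi)) = frame j \<kappa> x y \<phi>"
    unfolding frame_def using assms by (simp add: trig_poly_periodic)
qed

lemma smooth_on_torus_vector:
  fixes f g h :: "real ^ 3 \<Rightarrow> 'b::euclidean_space"
  assumes "smooth_on_torus f" "smooth_on_torus g" "smooth_on_torus h"
  shows "smooth_on_torus (\<lambda>\<phi>. vector [f \<phi>, g \<phi>, h \<phi>] :: 'b ^ 3)"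
  unfolding smooth_on_torus_def smooth_def
proof (intro conjI allI Ck_vec)
  show "Ck n (\<lambda>\<phi>. (vector [f \<phi>, g \<phi>, h \<phi>] :: 'b ^ 3) $ i)" for n i
    using exhaust_3 [of i] assms by (auto simp: smooth_on_torus_def smooth_def)
qed (use assms in \<open>simp add: smooth_on_torus_def\<close>)

lemma smooth_on_torus_differentiable: "smooth_on_torus f \<Longrightarrow> f differentiable (at \<phi>)"
  unfolding smooth_on_torus_def smooth_def by (metis Ck.simps(2))

lemma real_deriv_vector:
  fixes f g h :: "real ^ 3 \<Rightarrow> 'b::euclidean_space"
  assumes "smooth_on_torus f" "smooth_on_torus g" "smooth_on_torus h"
  shows "real_deriv (\<lambda>\<phi>. vector [f \<phi>, g \<phi>, h \<phi>] :: 'b ^ 3) \<phi> v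
    = vector [real_deriv f \<phi> v, real_deriv g \<phi> v, real_deriv h \<phi> v]"
  by (intro real_deriv_eqI has_derivative_vector3)
    (use assms in \<open>simp_all add: smooth_on_torus_differentiable flip: frechet_derivative_works\<close>)

text \<open>In the basis 1 + i \<kappa>, i the coordinates of \<open>G\<close> are
  \<open>Re G\<close> and \<open>Im G - \<kappa> * Re G\<close>, the latter being
  \<open>Re (- Complex \<kappa> 1 * G)\<close>. The \<open>f\<close>-term is tangential and lowers
  only the second by \<open>R * f\<close>. The first equation has multiplier 2 \<alpha> + i
  (\<open>k \<bullet> \<omega>\<close>), which never vanishes; the second has i
  (\<open>k \<bullet> \<omega>\<close>), hence the nonresonance assumption.\<close>

lemma component_solution:
  fixes \<omega> :: "real ^ 3"
  assumes "\<alpha> \<noteq> 0" "\<gamma> \<noteq> 0" "R\<^sup>2 = - \<alpha> / \<gamma>" "\<omega> $ j = limit_cycle_frequency \<alpha> \<beta> \<gamma> \<delta>" "\<kappa> = \<delta> / \<gamma>"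
    and "trig_poly integral_vec (\<lambda>\<phi>. Re (G \<phi>))"
    and "trig_poly (nonresonant \<omega>) (\<lambda>\<phi>. Re (- Complex \<kappa> 1 * G \<phi>) - R * f \<phi>)"
  obtains v where "smooth_on_torus v" and
    "\<And>\<phi>. real_deriv v \<phi> \<omega> - oscillator_deriv \<alpha> \<beta> \<gamma> \<delta> (of_real R * cis (\<phi> $ j)) (v \<phi>)
      + \<i> * of_real (f \<phi>) * R * cis (\<phi> $ j) = cis (\<phi> $ j) * G \<phi>"
proof -
  from assms(6) obtain x where x: "trig_poly integral_vec x"
    and dx: "\<And>\<phi>. real_deriv x \<phi> \<omega> + 2 * \<alpha> * x \<phi> = Re (G \<phi>)"
    by (rule trig_poly_directional_solution [where \<mu> = "2 * \<alpha>"]) (use \<open>\<alpha> \<noteq> 0\<close> in auto)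
  from assms(7) obtain y where y: "trig_poly (nonresonant \<omega>) y"
    and dy: "\<And>\<phi>. real_deriv y \<phi> \<omega> + 0 * y \<phi> = Re (- Complex \<kappa> 1 * G \<phi>) - R * f \<phi>"
    by (rule trig_poly_directional_solution [where \<mu> = 0]) auto
  have y': "trig_poly integral_vec y"
    using y by (rule trig_poly_mono) auto
  show thesis
  proof
    show "smooth_on_torus (frame j \<kappa> x y)"
      using x y' by (rule smooth_on_torus_frame)
    fix \<phi>
    have "Complex (real_deriv x \<phi> \<omega> + 2 * \<alpha> * x \<phi>) (\<kappa> * (real_deriv x \<phi> \<omega> + 2 * \<alpha> * x \<phi>) + real_deriv y \<phi> \<omega>)
        + \<i> * of_real (f \<phi>) * R = G \<phi>"
      unfolding dx using dy [of \<phi>] by (simp add: complex_eq_iff algebra_simps)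
    note G = this [symmetric]
    show "real_deriv (frame j \<kappa> x y) \<phi> \<omega>
        - oscillator_deriv \<alpha> \<beta> \<gamma> \<delta> (of_real R * cis (\<phi> $ j)) (frame j \<kappa> x y \<phi>)
        + \<i> * of_real (f \<phi>) * R * cis (\<phi> $ j) = cis (\<phi> $ j) * G \<phi>"
      unfolding linearised_frame [OF assms(2-5) trig_poly_differentiable [OF x]
          trig_poly_differentiable [OF y]]
      unfolding G frame_def by (simp add: distrib_left mult_ac)
  qed
qed

text \<open>
  The first order correction in the rotating frame, forced by \<open>R' cis \<psi>\<close> with
  \<open>\<psi>\<close> rotating at speed \<open>\<nu>\<close>, is \<open>M cis \<psi> + N cis (-\<psi>)\<close>.
\<close>

definition harmonic_pos :: "real \<Rightarrow> real \<Rightarrow> real \<Rightarrow> real \<Rightarrow> complex"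
  where "harmonic_pos \<alpha> \<kappa> R' \<nu> =
    (Complex 1 \<kappa> * (R' / Complex (2 * \<alpha>) \<nu>) + \<i> * (- Complex \<kappa> 1 * R' / Complex 0 \<nu>)) / 2"

definition harmonic_neg :: "real \<Rightarrow> real \<Rightarrow> real \<Rightarrow> real \<Rightarrow> complex"
  where "harmonic_neg \<alpha> \<kappa> R' \<nu> =
    (Complex 1 \<kappa> * cnj (R' / Complex (2 * \<alpha>) \<nu>) + \<i> * cnj (- Complex \<kappa> 1 * R' / Complex 0 \<nu>)) / 2"

definition harmonic :: "real \<Rightarrow> real \<Rightarrow> real \<Rightarrow> real \<Rightarrow> real \<Rightarrow> complex"
  where "harmonic \<alpha> \<kappa> R' \<nu> \<psi> = harmonic_pos \<alpha> \<kappa> R' \<nu> * cis \<psi> + harmonic_neg \<alpha> \<kappa> R' \<nu> * cis (- \<psi>)"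

text \<open>The forcing is a single nonresonant wave, so no phase correction is required. The
  solution is explicit because its amplitudes enter the second order.\<close>

lemma first_order_component:
  fixes \<omega> :: "real ^ 3" and R' :: real
  assumes "\<gamma> \<noteq> 0" "R\<^sup>2 = - \<alpha> / \<gamma>" "\<omega> $ j = limit_cycle_frequency \<alpha> \<beta> \<gamma> \<delta>" "\<kappa> = \<delta> / \<gamma>"
    and "integral_vec k" "k \<bullet> \<omega> \<noteq> 0"
  defines "v \<equiv> \<lambda>\<phi>. cis (\<phi> $ j) * harmonic \<alpha> \<kappa> R' (k \<bullet> \<omega>) (k \<bullet> \<phi>)"
  shows "smooth_on_torus v"
    and "real_deriv v \<phi> \<omega> - oscillator_deriv \<alpha> \<beta> \<gamma> \<delta> (of_real R * cis (\<phi> $ j)) (v \<phi>)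
      = cis (\<phi> $ j) * (R' * cis (k \<bullet> \<phi>))"
proof -
  define x where "x \<phi> = Re (R' / Complex (2 * \<alpha>) (k \<bullet> \<omega>) * cis (k \<bullet> \<phi>))" for \<phi>
  define y where "y \<phi> = Re (- Complex \<kappa> 1 * R' / Complex 0 (k \<bullet> \<omega>) * cis (k \<bullet> \<phi>))" for \<phi>
  have x: "trig_poly integral_vec x" and y: "trig_poly integral_vec y"
    unfolding x_def y_def by (intro trig_poly.wave assms(5))+
  have dx: "real_deriv x \<phi> \<omega> + 2 * \<alpha> * x \<phi> = Re (R' * cis (k \<bullet> \<phi>))" for \<phi>
    unfolding x_def using assms(6) by (intro wave_directional_solution) auto
  have dy: "real_deriv y \<phi> \<omega> + 0 * y \<phi> = Re (- Complex \<kappa> 1 * R' * cis (k \<bullet> \<phi>))" for \<phi>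
    unfolding y_def using assms(6) by (intro wave_directional_solution) auto
  \<comment> \<open>Writing each real part as half the sum of a number and its conjugate separates
    the \<open>cis \<psi>\<close> part from the \<open>cis (- \<psi>)\<close> part.\<close>
  have aux: "Complex (Re (p * z)) (\<kappa> * Re (p * z) + Re (q * z))
    = (Complex 1 \<kappa> * p + \<i> * q) / 2 * z + (Complex 1 \<kappa> * cnj p + \<i> * cnj q) / 2 * cnj z" for p q z
    by (simp add: complex_eq_iff field_simps)
  have v: "v = frame j \<kappa> x y"
    by (rule ext) (simp only: v_def frame_def x_def y_def aux harmonic_def harmonic_pos_def
        harmonic_neg_def cis_cnj)
  show "smooth_on_torus v"
    unfolding v using x y by (rule smooth_on_torus_frame)
  show "real_deriv v \<phi> \<omega> - oscillator_deriv \<alpha> \<beta> \<gamma> \<delta> (of_real R * cis (\<phi> $ j)) (v \<phi>)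
      = cis (\<phi> $ j) * (R' * cis (k \<bullet> \<phi>))"
    unfolding v linearised_frame [OF assms(1-4) trig_poly_differentiable [OF x]
        trig_poly_differentiable [OF y]]
    using dx [of \<phi>] dy [of \<phi>] by (simp add: frame_def complex_eq_iff algebra_simps)
qed

subsection \<open>The second order\<close>

text \<open>Parity: every product of two harmonics in \<psi> and -\<psi> has frequency 0 or
  \<plusminus>2. The left side has the form of the second-order forcing of an oscillator in its own
  frame, \<open>u\<close> being its own response and \<open>M'\<close>, \<open>N'\<close> the
  amplitudes of its neighbour.\<close>

lemma second_order_harmonics:
  fixes M N M' N' \<Gamma> :: complex
  defines "u \<equiv> \<lambda>\<psi>. M * cis \<psi> + N * cis (- \<psi>)"
  obtains g\<^sub>0 g\<^sub>1 g\<^sub>2 where "\<And>\<psi>. cis \<psi> * (M' * cis (- \<psi>) + N' * cis \<psi>)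
      + \<Gamma> * ((u \<psi>)\<^sup>2 + 2 * (u \<psi> * cnj (u \<psi>)))
    = g\<^sub>0 + g\<^sub>1 * cis (2 * \<psi>) + g\<^sub>2 * cis (- 2 * \<psi>)"
proof
  fix \<psi>
  \<comment> \<open>With the conjugates as independent unknowns and \<open>w\<close> the inverse of
    \<open>z\<close>, the claim is a polynomial identity.\<close>
  have *: "z * (M' * w + N' * z)
      + \<Gamma> * ((M * z + N * w)\<^sup>2 + 2 * ((M * z + N * w) * (M\<^sub>c * w + N\<^sub>c * z)))
    = (M' + \<Gamma> * (2 * M * N + 2 * (M * M\<^sub>c + N * N\<^sub>c)))
      + (N' + \<Gamma> * (M\<^sup>2 + 2 * M * N\<^sub>c)) * (z * z) + \<Gamma> * (N\<^sup>2 + 2 * N * M\<^sub>c) * (w * w)"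
    if "z * w = 1" for z w M\<^sub>c N\<^sub>c
    using that by algebra
  have cis2: "cis (2 * \<psi>) = cis \<psi> * cis \<psi>" "cis (- 2 * \<psi>) = cis (- \<psi>) * cis (- \<psi>)"
    by (simp_all add: cis_mult)
  show "cis \<psi> * (M' * cis (- \<psi>) + N' * cis \<psi>) + \<Gamma> * ((u \<psi>)\<^sup>2 + 2 * (u \<psi> * cnj (u \<psi>)))
    = (M' + \<Gamma> * (2 * M * N + 2 * (M * cnj M + N * cnj N)))
      + (N' + \<Gamma> * (M\<^sup>2 + 2 * M * cnj N)) * cis (2 * \<psi>)
      + \<Gamma> * (N\<^sup>2 + 2 * N * cnj M) * cis (- 2 * \<psi>)"
    unfolding cis2 u_def using * [of "cis \<psi>" "cis (- \<psi>)" "cnj M" "cnj N"]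
    by (simp add: cis_cnj cis_mult)
qed

lemma trig_poly_second_harmonic:
  assumes "K (2 *\<^sub>R k)" "K (- 2 *\<^sub>R k)"
  shows "trig_poly K (\<lambda>\<phi>. Re (L * (g\<^sub>1 * cis (2 * (k \<bullet> \<phi>)) + g\<^sub>2 * cis (- 2 * (k \<bullet> \<phi>)))))"
  using trig_poly.add [OF trig_poly.wave [of K, OF assms(1), of "L * g\<^sub>1"]
      trig_poly.wave [of K, OF assms(2), of "L * g\<^sub>2"]]
  by (simp add: algebra_simps)

section \<open>From the phase field to the combination angle\<close>

text \<open>In the difference of components 1 and 3 the zeroth order cancels by equality of
  frequencies and the first order vanishes. The remainders of the two components add up to the
  constant \<open>2 * C\<close>.\<close>

lemma combination_angle_law_if:
  assumes f: "phase_field_expansion f \<omega> f\<^sub>1 f\<^sub>2" and "\<omega> $ 1 = \<omega> $ 3"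
    and f1: "\<And>\<phi>. f\<^sub>1 \<phi> = 0" and f2: "\<And>\<phi>. f\<^sub>2 \<phi> $ 1 - f\<^sub>2 \<phi> $ 3 = g (\<phi> $ 1 - \<phi> $ 3)"
  shows "combination_angle_law f g"
proof -
  obtain C \<epsilon>0 where "\<epsilon>0 > 0" and C: "\<And>\<epsilon> \<phi>. \<bar>\<epsilon>\<bar> < \<epsilon>0 \<Longrightarrow>
      norm (f \<epsilon> \<phi> - (\<omega> + \<epsilon> *\<^sub>R f\<^sub>1 \<phi> + \<epsilon>\<^sup>2 *\<^sub>R f\<^sub>2 \<phi>)) \<le> C * \<bar>\<epsilon>\<bar> ^ 3"
    using f unfolding phase_field_expansion_def by blast
  have bound: "\<bar>(f \<epsilon> \<phi> $ 1 - f \<epsilon> \<phi> $ 3) - \<epsilon>\<^sup>2 * g (\<phi> $ 1 - \<phi> $ 3)\<bar> \<le> 2 * C * \<bar>\<epsilon>\<bar> ^ 3"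
    if "\<bar>\<epsilon>\<bar> < \<epsilon>0" for \<epsilon> \<phi>
  proof -
    let ?r = "f \<epsilon> \<phi> - (\<omega> + \<epsilon> *\<^sub>R f\<^sub>1 \<phi> + \<epsilon>\<^sup>2 *\<^sub>R f\<^sub>2 \<phi>)"
    have "(f \<epsilon> \<phi> $ 1 - f \<epsilon> \<phi> $ 3) - \<epsilon>\<^sup>2 * g (\<phi> $ 1 - \<phi> $ 3) = ?r $ 1 - ?r $ 3"
      using assms(2) by (simp add: f1 f2 [symmetric] algebra_simps)
    moreover have "\<bar>?r $ i\<bar> \<le> C * \<bar>\<epsilon>\<bar> ^ 3" for i
      using component_le_norm_cart [of ?r i] C [OF that, of \<phi>] by linarith
    from this [of 1] this [of 3] have "\<bar>?r $ 1 - ?r $ 3\<bar> \<le> 2 * C * \<bar>\<epsilon>\<bar> ^ 3"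
      by linarith
    ultimately show ?thesis by simp
  qed
  show ?thesis
    unfolding combination_angle_law_def
  proof (intro exI conjI allI impI ballI)
    fix \<epsilon> I \<phi> t
    assume *: "\<bar>\<epsilon>\<bar> < \<epsilon>0 \<and> is_interval I \<and> solves_ode \<phi> (f \<epsilon>) I" "t \<in> I"
    then have "(\<phi> has_derivative (\<lambda>h. h *\<^sub>R f \<epsilon> (\<phi> t))) (at t within I)"
      by (simp add: solves_ode_def has_vector_derivative_def)
    from bounded_linear.has_derivative [OF bounded_linear_vec_nth this]
    show "((\<lambda>s. \<phi> s $ 1 - \<phi> s $ 3) has_real_derivative f \<epsilon> (\<phi> t) $ 1 - f \<epsilon> (\<phi> t) $ 3) (at t within I)"
      unfolding has_field_derivative_def
      by (auto intro!: derivative_eq_intros simp: algebra_simps)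
    show "\<bar>(f \<epsilon> (\<phi> t) $ 1 - f \<epsilon> (\<phi> t) $ 3) - \<epsilon>\<^sup>2 * g (\<phi> t $ 1 - \<phi> t $ 3)\<bar> \<le> 2 * C * \<bar>\<epsilon>\<bar> ^ 3"
      using * by (intro bound) simp
  qed (rule \<open>\<epsilon>0 > 0\<close>)
qed

section \<open>The resonant amplitude and rotation of the quadratic terms\<close>

text \<open>These are minus the imaginary part and the real part of
  \<open>- Complex \<kappa> 1\<close> times the amplitude, that is, its tangential projection for an
  observer with shear \<kappa>. With \<nu> = \<open>\<omega>\<^sub>1 - \<omega>\<^sub>2\<close>,
  \<kappa> = \<delta>/\<gamma> and \<open>\<kappa>' = d / c\<close> the factors after
  \<open>R'\<close> become \<open>A\<close> and \<open>B\<close>.\<close>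

lemma harmonic_pos_parts:
  assumes "R' \<noteq> 0" "\<nu> \<noteq> 0"
  shows "Re (harmonic_pos a \<kappa>' R' \<nu>) + \<kappa> * Im (harmonic_pos a \<kappa>' R' \<nu>)
      = R' * (1 / (4 * a\<^sup>2 + \<nu>\<^sup>2) * (\<kappa> * (- \<nu>) + a * (1 + \<kappa>' * \<kappa>) + 2 * a\<^sup>2 * (\<kappa>' + \<kappa>) * (1 / (- \<nu>))))"
    and "Im (harmonic_pos a \<kappa>' R' \<nu>) - \<kappa> * Re (harmonic_pos a \<kappa>' R' \<nu>)
      = R' * (1 / (4 * a\<^sup>2 + \<nu>\<^sup>2) * (- \<nu> + a * (\<kappa>' - \<kappa>) + 2 * a\<^sup>2 * (1 - \<kappa>' * \<kappa>) * (1 / (- \<nu>))))"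
proof -
  have D: "4 * a\<^sup>2 + \<nu>\<^sup>2 \<noteq> 0" "(2 * a)\<^sup>2 + \<nu>\<^sup>2 = 4 * a\<^sup>2 + \<nu>\<^sup>2"
    using assms by (auto simp: power_mult_distrib add_nonneg_eq_0_iff)
  have c: "R' / Complex (2 * a) \<nu> = Complex (R' * (2 * a) / (4 * a\<^sup>2 + \<nu>\<^sup>2)) (- R' * \<nu> / (4 * a\<^sup>2 + \<nu>\<^sup>2))"
    by (simp add: complex_eq_iff Re_divide Im_divide D)
  have s: "- Complex \<kappa>' 1 * R' / Complex 0 \<nu> = Complex (- R' / \<nu>) (R' * \<kappa>' / \<nu>)"
    using assms by (simp add: complex_eq_iff Re_divide Im_divide power2_eq_square)
  have "harmonic_pos a \<kappa>' R' \<nu> = Complex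
     ((R' * (2 * a) / (4 * a\<^sup>2 + \<nu>\<^sup>2) + \<kappa>' * R' * \<nu> / (4 * a\<^sup>2 + \<nu>\<^sup>2) - R' * \<kappa>' / \<nu>) / 2)
     ((\<kappa>' * R' * (2 * a) / (4 * a\<^sup>2 + \<nu>\<^sup>2) - R' * \<nu> / (4 * a\<^sup>2 + \<nu>\<^sup>2) - R' / \<nu>) / 2)"
    unfolding harmonic_pos_def c s by (simp add: complex_eq_iff)
  then show "Re (harmonic_pos a \<kappa>' R' \<nu>) + \<kappa> * Im (harmonic_pos a \<kappa>' R' \<nu>)
      = R' * (1 / (4 * a\<^sup>2 + \<nu>\<^sup>2) * (\<kappa> * (- \<nu>) + a * (1 + \<kappa>' * \<kappa>) + 2 * a\<^sup>2 * (\<kappa>' + \<kappa>) * (1 / (- \<nu>))))"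
    and "Im (harmonic_pos a \<kappa>' R' \<nu>) - \<kappa> * Re (harmonic_pos a \<kappa>' R' \<nu>)
      = R' * (1 / (4 * a\<^sup>2 + \<nu>\<^sup>2) * (- \<nu> + a * (\<kappa>' - \<kappa>) + 2 * a\<^sup>2 * (1 - \<kappa>' * \<kappa>) * (1 / (- \<nu>))))"
    using assms D(1) by (simp_all add: divide_simps) (simp_all add: algebra_simps power2_eq_square)
qed

text \<open>The cubic term commutes with rotations, so the common phase factors out of half its
  second derivative.\<close>

lemma second_derivative_in_frame:
  "\<Gamma> * ((cis x * u)\<^sup>2 * cnj (of_real r * cis x)
      + 2 * (of_real r * cis x) * (cis x * u * cnj (cis x * u)))
    = cis x * (\<Gamma> * of_real r * (u\<^sup>2 + 2 * (u * cnj u)))"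
proof -
  have *: "\<Gamma> * ((z * u)\<^sup>2 * (r * w) + 2 * (r * z) * (z * u * (w * u')))
    = z * (\<Gamma> * r * (u\<^sup>2 + 2 * (u * u')))" if "z * w = 1" for z w u' r :: complex
    using that by algebra
  show ?thesis
    using * [of "cis x" "cis (- x)" "of_real r" "cnj u"] by (simp add: cis_cnj cis_mult)
qed

lemma cis_mult_left: "cis x * (r * cis y) = r * cis (x + y)"
  by (simp add: cis_mult mult.left_commute [of "cis x"])

section \<open>Both orders of the expansion for the three coupled oscillators\<close>

theorem mainTheorem4:
  fixes \<alpha> \<beta> \<gamma> \<delta> a b c d \<omega>\<^sub>1 \<omega>\<^sub>2 \<omega>\<^sub>3 R\<^sub>1 R\<^sub>2 R\<^sub>3 A B :: real
    and \<omega> :: "real ^ 3"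
    and e\<^sub>0 :: "real ^ 3 \<Rightarrow> complex ^ 3"
  assumes "\<alpha> * \<gamma> < 0" and "a * c < 0"
    and "\<beta> * \<gamma> - \<alpha> * \<delta> \<noteq> 0" and "b * c - a * d \<noteq> 0"
    and "\<omega>\<^sub>1 = limit_cycle_frequency \<alpha> \<beta> \<gamma> \<delta>"
    and "\<omega>\<^sub>2 = limit_cycle_frequency a b c d"
    and "\<omega>\<^sub>3 = limit_cycle_frequency \<alpha> \<beta> \<gamma> \<delta>"
    and "\<omega>\<^sub>1 \<noteq> \<omega>\<^sub>2"
    and "\<omega> = vector [\<omega>\<^sub>1, \<omega>\<^sub>2, \<omega>\<^sub>3]"
    and "R\<^sub>1 = limit_cycle_radius \<alpha> \<gamma>"
    and "R\<^sub>2 = limit_cycle_radius a c"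
    and "R\<^sub>3 = limit_cycle_radius \<alpha> \<gamma>"
    and "e\<^sub>0 = embedding0 R\<^sub>1 R\<^sub>2 R\<^sub>3"
    and "A = 1 / (4 * a\<^sup>2 + (\<omega>\<^sub>1 - \<omega>\<^sub>2)\<^sup>2) *
           (\<delta> / \<gamma> * (\<omega>\<^sub>2 - \<omega>\<^sub>1) + a * (1 + d * \<delta> / (c * \<gamma>))
            + 2 * a\<^sup>2 * (d / c + \<delta> / \<gamma>) * (1 / (\<omega>\<^sub>2 - \<omega>\<^sub>1)))"
    and "B = 1 / (4 * a\<^sup>2 + (\<omega>\<^sub>1 - \<omega>\<^sub>2)\<^sup>2) *
           ((\<omega>\<^sub>2 - \<omega>\<^sub>1) + a * (d / c - \<delta> / \<gamma>)
            + 2 * a\<^sup>2 * (1 - d * \<delta> / (c * \<gamma>)) * (1 / (\<omega>\<^sub>2 - \<omega>\<^sub>1)))"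
  shows "\<exists>e\<^sub>1 e\<^sub>2 :: real ^ 3 \<Rightarrow> complex ^ 3. \<exists>f\<^sub>1 f\<^sub>2 :: real ^ 3 \<Rightarrow> real ^ 3.
    smooth_on_torus e\<^sub>1 \<and> smooth_on_torus e\<^sub>2 \<and> smooth_on_torus f\<^sub>1 \<and> smooth_on_torus f\<^sub>2 \<and>
    first_iterative_eq (F0 \<alpha> \<beta> \<gamma> \<delta> a b c d) F1 \<omega> e\<^sub>0 e\<^sub>1 f\<^sub>1 \<and>
    second_iterative_eq (F0 \<alpha> \<beta> \<gamma> \<delta> a b c d) F1 \<omega> e\<^sub>0 e\<^sub>1 e\<^sub>2 f\<^sub>1 f\<^sub>2 \<and>
    (\<forall>\<phi>. f\<^sub>1 \<phi> = 0) \<and>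
    (\<forall>\<phi>. f\<^sub>2 \<phi> $ 1 - f\<^sub>2 \<phi> $ 3
        = - A * sin (\<phi> $ 1 - \<phi> $ 3) + B * (1 - cos (\<phi> $ 1 - \<phi> $ 3))) \<and>
    (\<forall>f. phase_field_expansion f \<omega> f\<^sub>1 f\<^sub>2 \<longrightarrow>
        combination_angle_law f (\<lambda>\<Phi>. - A * sin \<Phi> + B * (1 - cos \<Phi>)))"
proof -
  define \<kappa> \<kappa>' \<nu> where "\<kappa> = \<delta> / \<gamma>" and "\<kappa>' = d / c" and "\<nu> = \<omega>\<^sub>1 - \<omega>\<^sub>2"
  have nz: "\<alpha> \<noteq> 0" "\<gamma> \<noteq> 0" "a \<noteq> 0" "c \<noteq> 0" and \<nu>: "\<nu> \<noteq> 0"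
    using assms(1,2,8) by (auto simp: \<nu>_def)
  have "- \<alpha> / \<gamma> > 0" "- a / c > 0"
    using assms(1,2) by (auto simp: divide_less_0_iff mult_less_0_iff)
  then have R: "R\<^sub>1\<^sup>2 = - \<alpha> / \<gamma>" "R\<^sub>2\<^sup>2 = - a / c" "R\<^sub>1 > 0" "R\<^sub>2 > 0" and R3: "R\<^sub>3 = R\<^sub>1"
    using assms(10-12) by (simp_all add: limit_cycle_radius_def)
  have \<omega>: "\<omega> $ 1 = limit_cycle_frequency \<alpha> \<beta> \<gamma> \<delta>" "\<omega> $ 2 = limit_cycle_frequency a b c d"
    "\<omega> $ 3 = limit_cycle_frequency \<alpha> \<beta> \<gamma> \<delta>" and \<omega>\<nu>: "\<omega> $ 1 - \<omega> $ 2 = \<nu>" "\<omega> $ 3 = \<omega> $ 1"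
    using assms(5-9) by (simp_all add: \<nu>_def)

  \<comment> \<open>\<open>k\<^sub>j \<bullet> \<phi>\<close> is the phase of the oscillator driving
    oscillator j, measured from the phase of j. It rotates at speed \<plusminus>\<nu>, so
    first-order waves are nonresonant.\<close>
  define k\<^sub>1 k\<^sub>2 k\<^sub>3 :: "real ^ 3"
    where "k\<^sub>1 = axis 2 1 - axis 1 1" and "k\<^sub>2 = axis 1 1 - axis 2 1" and "k\<^sub>3 = axis 2 1 - axis 3 1"
  note k_defs = k\<^sub>1_def k\<^sub>2_def k\<^sub>3_def
  have k\<phi>: "k\<^sub>1 \<bullet> \<phi> = \<phi> $ 2 - \<phi> $ 1" "k\<^sub>2 \<bullet> \<phi> = \<phi> $ 1 - \<phi> $ 2" "k\<^sub>3 \<bullet> \<phi> = \<phi> $ 2 - \<phi> $ 3" for \<phi>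
    by (simp_all add: k_defs inner_diff_left inner_axis')
  have k\<omega>: "k\<^sub>1 \<bullet> \<omega> = - \<nu>" "k\<^sub>2 \<bullet> \<omega> = \<nu>" "k\<^sub>3 \<bullet> \<omega> = - \<nu>"
    using \<omega>\<nu> by (simp_all add: k\<phi>)
  have k\<omega>0: "k\<^sub>1 \<bullet> \<omega> \<noteq> 0" "k\<^sub>2 \<bullet> \<omega> \<noteq> 0" "k\<^sub>3 \<bullet> \<omega> \<noteq> 0"
    using \<nu> by (simp_all add: k\<omega>)
  have int: "integral_vec k\<^sub>1" "integral_vec k\<^sub>2" "integral_vec k\<^sub>3"
    by (simp_all add: k_defs axis_def)
  have nonres: "nonresonant \<omega> (2 *\<^sub>R k)" "nonresonant \<omega> (- 2 *\<^sub>R k)"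
    if "integral_vec k" "k \<bullet> \<omega> \<noteq> 0" for k
    using that by simp_all

  define M\<^sub>2 N\<^sub>2 where "M\<^sub>2 = harmonic_pos a \<kappa>' R\<^sub>1 \<nu>" and "N\<^sub>2 = harmonic_neg a \<kappa>' R\<^sub>1 \<nu>"
  \<comment> \<open>Oscillators 1 and 3 share \<open>u\<^sub>1\<close>: they have equal parameters
    and are driven by oscillator 2 at the same relative speed -\<nu>.\<close>
  define u\<^sub>1 u\<^sub>2 where "u\<^sub>1 = harmonic \<alpha> \<kappa> R\<^sub>2 (- \<nu>)" and "u\<^sub>2 = harmonic a \<kappa>' R\<^sub>1 \<nu>"
  define v\<^sub>1 v\<^sub>2 v\<^sub>3 where "v\<^sub>1 \<phi> = cis (\<phi> $ 1) * u\<^sub>1 (k\<^sub>1 \<bullet> \<phi>)"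
    and "v\<^sub>2 \<phi> = cis (\<phi> $ 2) * u\<^sub>2 (k\<^sub>2 \<bullet> \<phi>)" and "v\<^sub>3 \<phi> = cis (\<phi> $ 3) * u\<^sub>1 (k\<^sub>3 \<bullet> \<phi>)" for \<phi> :: "real ^ 3"
  note v1 = first_order_component [where \<omega> = \<omega>, OF nz(2) R(1) \<omega>(1) \<kappa>_def int(1) k\<omega>0(1), of R\<^sub>2,
      unfolded k\<omega>, folded u\<^sub>1_def, folded v\<^sub>1_def]
  note v2 = first_order_component [where \<omega> = \<omega>, OF nz(4) R(2) \<omega>(2) \<kappa>'_def int(2) k\<omega>0(2), of R\<^sub>1,
      unfolded k\<omega>, folded u\<^sub>2_def, folded v\<^sub>2_def]
  note v3 = first_order_component [where \<omega> = \<omega>, OF nz(2) R(1) \<omega>(3) \<kappa>_def int(3) k\<omega>0(3), of R\<^sub>2,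
      unfolded k\<omega>, folded u\<^sub>1_def, folded v\<^sub>3_def]
  define e\<^sub>1 :: "real ^ 3 \<Rightarrow> complex ^ 3" where "e\<^sub>1 \<phi> = vector [v\<^sub>1 \<phi>, v\<^sub>2 \<phi>, v\<^sub>3 \<phi>]" for \<phi>
  define f\<^sub>1 :: "real ^ 3 \<Rightarrow> real ^ 3" where "f\<^sub>1 \<phi> = 0" for \<phi>
  have e1: "smooth_on_torus e\<^sub>1"
    unfolding e\<^sub>1_def [abs_def] by (intro smooth_on_torus_vector v1 v2 v3)
  have f1: "smooth_on_torus f\<^sub>1"
    by (simp add: smooth_on_torus_def smooth_def f\<^sub>1_def [abs_def] Ck_const)
  have first: "first_iterative_eq (F0 \<alpha> \<beta> \<gamma> \<delta> a b c d) F1 \<omega> e\<^sub>0 e\<^sub>1 f\<^sub>1"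
    unfolding first_iterative_eq_def assms(13) R3 e\<^sub>1_def [abs_def]
    by (simp add: real_deriv_vector v1(1) v2(1) v3(1) real_deriv_F0 real_deriv_embedding0 f\<^sub>1_def F1_def
        vec_eq_iff forall_3 embedding0_def v1(2) v2(2) v3(2) k\<phi> cis_mult_left)

  \<comment> \<open>Second-order forcing in the rotating frame: the first-order response of the
    neighbour, whose relative phase is the negative one, plus half the second derivative of the
    oscillator.\<close>
  define G\<^sub>1 where "G\<^sub>1 \<psi> = cis \<psi> * u\<^sub>2 (- \<psi>)
    + Complex \<gamma> \<delta> * R\<^sub>1 * ((u\<^sub>1 \<psi>)\<^sup>2 + 2 * (u\<^sub>1 \<psi> * cnj (u\<^sub>1 \<psi>)))" for \<psi>
  define G\<^sub>2 where "G\<^sub>2 \<psi> = cis \<psi> * u\<^sub>1 (- \<psi>)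
    + Complex c d * R\<^sub>2 * ((u\<^sub>2 \<psi>)\<^sup>2 + 2 * (u\<^sub>2 \<psi> * cnj (u\<^sub>2 \<psi>)))" for \<psi>
  \<comment> \<open>Oscillators 1 and 3 both see \<open>u\<^sub>2 (\<phi>\<^sub>1 - \<phi>\<^sub>2)\<close>: replacing \<open>\<phi>\<^sub>1\<close> by \<open>\<phi>\<^sub>3\<close> in the
    forcing of oscillator 1 misses that of oscillator 3 by these two waves, the first resonant.\<close>
  define G\<^sub>3 where "G\<^sub>3 \<phi> = G\<^sub>1 (k\<^sub>3 \<bullet> \<phi>) + M\<^sub>2 * (cis (\<phi> $ 1 - \<phi> $ 3) - 1)
    + N\<^sub>2 * (cis ((k\<^sub>1 + k\<^sub>3) \<bullet> \<phi>) - cis ((2 *\<^sub>R k\<^sub>3) \<bullet> \<phi>))" for \<phi>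
  obtain g\<^sub>0 g\<^sub>1 g\<^sub>2 where g: "\<And>\<psi>. G\<^sub>1 \<psi> = g\<^sub>0 + g\<^sub>1 * cis (2 * \<psi>) + g\<^sub>2 * cis (- 2 * \<psi>)"
    unfolding G\<^sub>1_def u\<^sub>1_def u\<^sub>2_def harmonic_def minus_minus by (rule second_order_harmonics) blast
  obtain h\<^sub>0 h\<^sub>1 h\<^sub>2 where h: "\<And>\<psi>. G\<^sub>2 \<psi> = h\<^sub>0 + h\<^sub>1 * cis (2 * \<psi>) + h\<^sub>2 * cis (- 2 * \<psi>)"
    unfolding G\<^sub>2_def u\<^sub>1_def u\<^sub>2_def harmonic_def minus_minus by (rule second_order_harmonics) blast

  define g where "g \<Phi> = - A * sin \<Phi> + B * (1 - cos \<Phi>)" for \<Phi>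
  let ?L = "- Complex \<kappa> 1" and ?L' = "- Complex \<kappa>' 1"
  \<comment> \<open>These constants absorb the tangential parts of \<open>g\<^sub>0\<close> and
    \<open>h\<^sub>0\<close>, the only resonant terms of \<open>G\<^sub>1\<close> and
    \<open>G\<^sub>2\<close>.\<close>
  define p q where "p = Re (?L * g\<^sub>0) / R\<^sub>1" and "q = Re (?L' * h\<^sub>0) / R\<^sub>2"
  have pq: "R\<^sub>1 * p = Re (?L * g\<^sub>0)" "R\<^sub>2 * q = Re (?L' * h\<^sub>0)"
    using R by (simp_all add: p_def q_def)
  have AB: "Re M\<^sub>2 + \<kappa> * Im M\<^sub>2 = R\<^sub>1 * A" "Im M\<^sub>2 - \<kappa> * Re M\<^sub>2 = R\<^sub>1 * B"
    using harmonic_pos_parts [of R\<^sub>1 \<nu> a \<kappa>' \<kappa>] R(3) \<nu>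
    by (simp_all add: M\<^sub>2_def assms(14,15) \<nu>_def \<kappa>_def \<kappa>'_def)
  \<comment> \<open>The tangential part of the extra resonant wave seen by oscillator 3. Absorbing
    it turns the third phase correction into \<open>p - g \<Phi>\<close>, so components 1 and 3
    differ by exactly \<open>g \<Phi>\<close>.\<close>
  have resonant: "Re (?L * (M\<^sub>2 * (cis \<Phi> - 1))) = - R\<^sub>1 * g \<Phi>" for \<Phi>
  proof -
    have "Re (?L * (M\<^sub>2 * (cis \<Phi> - 1)))
        = (Re M\<^sub>2 + \<kappa> * Im M\<^sub>2) * sin \<Phi> - (Im M\<^sub>2 - \<kappa> * Re M\<^sub>2) * (1 - cos \<Phi>)"
      by (simp add: algebra_simps)
    then show ?thesis
      unfolding AB by (simp add: g_def algebra_simps)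
  qed

  have rot: "(k\<^sub>1 + k\<^sub>3) \<bullet> \<omega> \<noteq> 0"
    using \<nu> by (simp add: inner_add_left k\<omega>)
  have int13: "integral_vec (k\<^sub>1 + k\<^sub>3)"
    using int by simp
  have nonres': "nonresonant \<omega> (k\<^sub>1 + k\<^sub>3)" "nonresonant \<omega> (2 *\<^sub>R k\<^sub>3)"
    using int13 rot nonres(1) [of k\<^sub>3] int(3) \<nu> k\<omega> by auto
  have const: "trig_poly integral_vec (\<lambda>\<phi> :: real ^ 3. r)" for r
    by (rule trig_poly_const) simp

  \<comment> \<open>Below, \<open>L\<close> is 1 for the radial projection and
    \<open>- Complex \<kappa> 1\<close> or \<open>- Complex \<kappa>' 1\<close> for the tangential
    one.\<close>
  have G1_nonres: "trig_poly (nonresonant \<omega>) (\<lambda>\<phi>. Re (L * G\<^sub>1 (k \<bullet> \<phi>)) - Re (L * g\<^sub>0))"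
    if "integral_vec k" "k \<bullet> \<omega> \<noteq> 0" for k L
    using trig_poly_second_harmonic [where K = "nonresonant \<omega>", OF nonres [OF that], of L g\<^sub>1 g\<^sub>2]
    by (simp add: g algebra_simps)
  have G2_nonres: "trig_poly (nonresonant \<omega>) (\<lambda>\<phi>. Re (L * G\<^sub>2 (k \<bullet> \<phi>)) - Re (L * h\<^sub>0))"
    if "integral_vec k" "k \<bullet> \<omega> \<noteq> 0" for k L
    using trig_poly_second_harmonic [where K = "nonresonant \<omega>", OF nonres [OF that], of L h\<^sub>1 h\<^sub>2]
    by (simp add: h algebra_simps)
  have G3_nonres: "trig_poly (nonresonant \<omega>)
      (\<lambda>\<phi>. Re (L * G\<^sub>3 \<phi>) - Re (L * g\<^sub>0) - Re (L * (M\<^sub>2 * (cis (\<phi> $ 1 - \<phi> $ 3) - 1))))" for L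
    using trig_poly.add [OF G1_nonres [OF int(3), of L] trig_poly.add
        [OF trig_poly.wave [of "nonresonant \<omega>", OF nonres'(1), of "L * N\<^sub>2"]
          trig_poly.wave [of "nonresonant \<omega>", OF nonres'(2), of "- L * N\<^sub>2"]]] \<nu> k\<omega>
    by (simp add: G\<^sub>3_def algebra_simps)
  have to_int: "trig_poly integral_vec f" if "trig_poly (nonresonant \<omega>) f" for f
    using that by (rule trig_poly_mono) auto
  \<comment> \<open>This frequency is integral but resonant, because oscillators 1 and 3 have equal
    frequencies. The wave may stay in the radial equation, where 2 \<alpha> \<noteq> 0.\<close>
  have wave\<Phi>: "trig_poly integral_vec (\<lambda>\<phi> :: real ^ 3. Re (C * cis (\<phi> $ 1 - \<phi> $ 3)))" for C
  proof -
    have "integral_vec (axis 1 1 - axis 3 1 :: real ^ 3)"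
      by (simp add: axis_def)
    from trig_poly.wave [of integral_vec, OF this, of C] show ?thesis
      by (simp add: inner_diff_left inner_axis')
  qed
  have "trig_poly integral_vec (\<lambda>\<phi>. Re (G\<^sub>1 (k\<^sub>1 \<bullet> \<phi>)))"
    using trig_poly.add [OF to_int [OF G1_nonres [OF int(1), of 1]]
        const [of "Re g\<^sub>0"]] \<nu> k\<omega> by simp
  moreover have "trig_poly (nonresonant \<omega>) (\<lambda>\<phi>. Re (?L * G\<^sub>1 (k\<^sub>1 \<bullet> \<phi>)) - R\<^sub>1 * p)"
    unfolding pq using int(1) \<nu> k\<omega> by (intro G1_nonres) auto
  ultimately obtain w\<^sub>1 where w1: "smooth_on_torus w\<^sub>1"
    "\<And>\<phi>. real_deriv w\<^sub>1 \<phi> \<omega> - oscillator_deriv \<alpha> \<beta> \<gamma> \<delta> (of_real R\<^sub>1 * cis (\<phi> $ 1)) (w\<^sub>1 \<phi>)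
      + \<i> * of_real p * R\<^sub>1 * cis (\<phi> $ 1) = cis (\<phi> $ 1) * G\<^sub>1 (k\<^sub>1 \<bullet> \<phi>)"
    by (rule component_solution [OF nz(1,2) R(1) \<omega>(1) \<kappa>_def]) blast
  have "trig_poly integral_vec (\<lambda>\<phi>. Re (G\<^sub>2 (k\<^sub>2 \<bullet> \<phi>)))"
    using trig_poly.add [OF to_int [OF G2_nonres [OF int(2), of 1]]
        const [of "Re h\<^sub>0"]] \<nu> k\<omega> by simp
  moreover have "trig_poly (nonresonant \<omega>) (\<lambda>\<phi>. Re (?L' * G\<^sub>2 (k\<^sub>2 \<bullet> \<phi>)) - R\<^sub>2 * q)"
    unfolding pq using int(2) \<nu> k\<omega> by (intro G2_nonres) auto
  ultimately obtain w\<^sub>2 where w2: "smooth_on_torus w\<^sub>2"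
    "\<And>\<phi>. real_deriv w\<^sub>2 \<phi> \<omega> - oscillator_deriv a b c d (of_real R\<^sub>2 * cis (\<phi> $ 2)) (w\<^sub>2 \<phi>)
      + \<i> * of_real q * R\<^sub>2 * cis (\<phi> $ 2) = cis (\<phi> $ 2) * G\<^sub>2 (k\<^sub>2 \<bullet> \<phi>)"
    by (rule component_solution [OF nz(3,4) R(2) \<omega>(2) \<kappa>'_def]) blast
  have "trig_poly integral_vec (\<lambda>\<phi>. Re (G\<^sub>3 \<phi>))"
    using trig_poly.add [OF to_int [OF G3_nonres [of 1]] trig_poly.add
        [OF wave\<Phi> [of M\<^sub>2] const [of "Re (g\<^sub>0 - M\<^sub>2)"]]]
    by (simp add: algebra_simps)
  moreover have "trig_poly (nonresonant \<omega>)
      (\<lambda>\<phi>. Re (?L * G\<^sub>3 \<phi>) - R\<^sub>1 * (p - g (\<phi> $ 1 - \<phi> $ 3)))"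
    using G3_nonres [of ?L] unfolding resonant pq [symmetric] by (simp add: algebra_simps)
  ultimately obtain w\<^sub>3 where w3: "smooth_on_torus w\<^sub>3"
    "\<And>\<phi>. real_deriv w\<^sub>3 \<phi> \<omega> - oscillator_deriv \<alpha> \<beta> \<gamma> \<delta> (of_real R\<^sub>1 * cis (\<phi> $ 3)) (w\<^sub>3 \<phi>)
      + \<i> * of_real (p - g (\<phi> $ 1 - \<phi> $ 3)) * R\<^sub>1 * cis (\<phi> $ 3) = cis (\<phi> $ 3) * G\<^sub>3 \<phi>"
    by (rule component_solution [OF nz(1,2) R(1) \<omega>(3) \<kappa>_def]) blast

  define e\<^sub>2 :: "real ^ 3 \<Rightarrow> complex ^ 3" where "e\<^sub>2 \<phi> = vector [w\<^sub>1 \<phi>, w\<^sub>2 \<phi>, w\<^sub>3 \<phi>]" for \<phi>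
  define f\<^sub>2 :: "real ^ 3 \<Rightarrow> real ^ 3"
    where "f\<^sub>2 \<phi> = vector [p, q, p - g (\<phi> $ 1 - \<phi> $ 3)]" for \<phi>
  have e2: "smooth_on_torus e\<^sub>2"
    unfolding e\<^sub>2_def [abs_def] by (intro smooth_on_torus_vector w1 w2 w3)
  have "p - g (\<phi> $ 1 - \<phi> $ 3)
      = Re (Complex B (- A) * cis (\<phi> $ 1 - \<phi> $ 3)) + (p - B)" for \<phi> :: "real ^ 3"
    by (simp add: g_def algebra_simps)
  then have "trig_poly integral_vec (\<lambda>\<phi> :: real ^ 3. p - g (\<phi> $ 1 - \<phi> $ 3))"
    using trig_poly.add [OF wave\<Phi> [of "Complex B (- A)"] const [of "p - B"]] by presburger
  then have f2: "smooth_on_torus f\<^sub>2"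
    unfolding f\<^sub>2_def [abs_def]
    by (intro smooth_on_torus_vector smooth_on_torus_trig_poly const)
  have second: "second_iterative_eq (F0 \<alpha> \<beta> \<gamma> \<delta> a b c d) F1 \<omega> e\<^sub>0 e\<^sub>1 e\<^sub>2 f\<^sub>1 f\<^sub>2"
    unfolding second_iterative_eq_def
  proof
    fix \<phi>
    have quad: "(1 / 2) *\<^sub>R second_deriv (F0 \<alpha> \<beta> \<gamma> \<delta> a b c d) (e\<^sub>0 \<phi>) (e\<^sub>1 \<phi>) (e\<^sub>1 \<phi>) = vector
      [cis (\<phi> $ 1) * (Complex \<gamma> \<delta> * R\<^sub>1 * ((u\<^sub>1 (k\<^sub>1 \<bullet> \<phi>))\<^sup>2 + 2 * (u\<^sub>1 (k\<^sub>1 \<bullet> \<phi>) * cnj (u\<^sub>1 (k\<^sub>1 \<bullet> \<phi>))))),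
       cis (\<phi> $ 2) * (Complex c d * R\<^sub>2 * ((u\<^sub>2 (k\<^sub>2 \<bullet> \<phi>))\<^sup>2 + 2 * (u\<^sub>2 (k\<^sub>2 \<bullet> \<phi>) * cnj (u\<^sub>2 (k\<^sub>2 \<bullet> \<phi>))))),
       cis (\<phi> $ 3) * (Complex \<gamma> \<delta> * R\<^sub>1 * ((u\<^sub>1 (k\<^sub>3 \<bullet> \<phi>))\<^sup>2 + 2 * (u\<^sub>1 (k\<^sub>3 \<bullet> \<phi>) * cnj (u\<^sub>1 (k\<^sub>3 \<bullet> \<phi>)))))]"
      unfolding second_deriv_F0 assms(13) R3 embedding0_def e\<^sub>1_def vector_3 v\<^sub>1_def v\<^sub>2_def v\<^sub>3_def
        second_derivative_in_frame by simp
    \<comment> \<open>The first product is the coupling term contained in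
      \<open>G\<^sub>1 (k\<^sub>3 \<bullet> \<phi>)\<close>, the second the actual response of
      oscillator 2 in the frame of oscillator 3. Their difference is the correction built into
      \<open>G\<^sub>3\<close>.\<close>
    have u2: "cis (k\<^sub>3 \<bullet> \<phi>) * u\<^sub>2 (- (k\<^sub>3 \<bullet> \<phi>)) = M\<^sub>2 + N\<^sub>2 * cis (2 * (k\<^sub>3 \<bullet> \<phi>))"
      "cis (k\<^sub>3 \<bullet> \<phi>) * u\<^sub>2 (k\<^sub>2 \<bullet> \<phi>) = M\<^sub>2 * cis (\<phi> $ 1 - \<phi> $ 3) + N\<^sub>2 * cis ((k\<^sub>1 + k\<^sub>3) \<bullet> \<phi>)"
      unfolding u\<^sub>2_def harmonic_def M\<^sub>2_def [symmetric] N\<^sub>2_def [symmetric] distrib_left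
        cis_mult_left inner_add_left k\<phi>
      by (simp_all add: algebra_simps)
    have shift: "cis (\<phi> $ 2) = cis (\<phi> $ 1) * cis (k\<^sub>1 \<bullet> \<phi>)" "cis (\<phi> $ 2) = cis (\<phi> $ 3) * cis (k\<^sub>3 \<bullet> \<phi>)"
      "cis (\<phi> $ 1) = cis (\<phi> $ 2) * cis (k\<^sub>2 \<bullet> \<phi>)"
      by (simp_all add: cis_mult k\<phi>)
    have "cis (\<phi> $ 1) * G\<^sub>1 (k\<^sub>1 \<bullet> \<phi>) = v\<^sub>2 \<phi>
        + cis (\<phi> $ 1) * (Complex \<gamma> \<delta> * R\<^sub>1 * ((u\<^sub>1 (k\<^sub>1 \<bullet> \<phi>))\<^sup>2 + 2 * (u\<^sub>1 (k\<^sub>1 \<bullet> \<phi>) * cnj (u\<^sub>1 (k\<^sub>1 \<bullet> \<phi>)))))"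
      unfolding G\<^sub>1_def v\<^sub>2_def shift(1) by (simp add: k\<phi> distrib_left)
    moreover have "cis (\<phi> $ 2) * G\<^sub>2 (k\<^sub>2 \<bullet> \<phi>) = v\<^sub>1 \<phi>
        + cis (\<phi> $ 2) * (Complex c d * R\<^sub>2 * ((u\<^sub>2 (k\<^sub>2 \<bullet> \<phi>))\<^sup>2 + 2 * (u\<^sub>2 (k\<^sub>2 \<bullet> \<phi>) * cnj (u\<^sub>2 (k\<^sub>2 \<bullet> \<phi>)))))"
      unfolding G\<^sub>2_def v\<^sub>1_def shift(3) by (simp add: k\<phi> distrib_left)
    moreover have "cis (\<phi> $ 3) * G\<^sub>3 \<phi> = v\<^sub>2 \<phi>
        + cis (\<phi> $ 3) * (Complex \<gamma> \<delta> * R\<^sub>1 * ((u\<^sub>1 (k\<^sub>3 \<bullet> \<phi>))\<^sup>2 + 2 * (u\<^sub>1 (k\<^sub>3 \<bullet> \<phi>) * cnj (u\<^sub>1 (k\<^sub>3 \<bullet> \<phi>)))))"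
      unfolding G\<^sub>3_def G\<^sub>1_def u2(1) v\<^sub>2_def shift(2) mult.assoc [of "cis (\<phi> $ 3)" "cis (k\<^sub>3 \<bullet> \<phi>)"] u2(2)
      by (simp add: algebra_simps)
    ultimately show "real_deriv e\<^sub>2 \<phi> \<omega> - real_deriv (F0 \<alpha> \<beta> \<gamma> \<delta> a b c d) (e\<^sub>0 \<phi>) (e\<^sub>2 \<phi>)
        + real_deriv e\<^sub>0 \<phi> (f\<^sub>2 \<phi>)
      = real_deriv F1 (e\<^sub>0 \<phi>) (e\<^sub>1 \<phi>)
        + (1 / 2) *\<^sub>R second_deriv (F0 \<alpha> \<beta> \<gamma> \<delta> a b c d) (e\<^sub>0 \<phi>) (e\<^sub>1 \<phi>) (e\<^sub>1 \<phi>)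
        - real_deriv e\<^sub>1 \<phi> (f\<^sub>1 \<phi>)"
      \<comment> \<open>The last term of the equation is the derivative of \<open>e\<^sub>1\<close>
        in the direction \<open>f\<^sub>1 \<phi> = 0\<close>, which vanishes by linearity.\<close>
      using w1(2) [of \<phi>] w2(2) [of \<phi>] w3(2) [of \<phi>]
        linear_0 [OF linear_frechet_derivative [OF smooth_on_torus_differentiable [OF e1]], of \<phi>]
      unfolding quad
      by (simp add: e\<^sub>2_def [abs_def] real_deriv_vector w1(1) w2(1) w3(1) real_deriv_F0 real_deriv_F1
        assms(13) R3 real_deriv_embedding0 embedding0_def e\<^sub>1_def f\<^sub>1_def f\<^sub>2_def F1_def vec_eq_iff forall_3)
  qed
  show ?thesis
    using e1 e2 f1 f2 first second
    by (intro exI [of _ e\<^sub>1] exI [of _ e\<^sub>2] exI [of _ f\<^sub>1] exI [of _ f\<^sub>2])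
      (auto intro!: combination_angle_law_if simp: \<omega>\<nu> f\<^sub>1_def f\<^sub>2_def g_def)
qed

end
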